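(* Let $L<H$ be reals and $\epsilon\ge 0$. Let $(A,p)$ be a mechanism for the path auction with $\epsilon$-perturbed domain (so $A$ always selects a path of minimum total reported cost). If $(A,p)$ is bribeproof, then it is a $\left(\frac12\right)$-linear mechanism: there exist constants $f_1,\dots,f_4\in\mathbb{R}$ such that for every $\theta$ in the domain and every $i\in\{1,2,3,4\}$, $$p_i(\theta)=f_i+A_i(\theta)\cdot\frac{L+H}{2}.$$
   Context: Path auction with $\epsilon$-perturbed domain: there are four agents, each owning one edge of the network with nodes $s,u,d,t$ and edges $su$ (agent 1), $ut$ (agent 2), $sd$ (agent 3), $dt$ (agent 4). The two feasible allocations, corresponding to the two $s$–$t$ paths, are $(1,1,0,0)$ (upper path) and $(0,0,1,1)$ (lower path). The types domains are $\Theta_1=\Theta_2=\{L-\epsilon,H+\epsilon\}$ and $\Theta_3=\Theta_4=\{L,H\}$; $\Theta=\Theta_1\times\cdots\times\Theta_4$. The type $\theta_i$ is the cost of agent $i$ per unit of work (cost of her edge). A mechanism is a pair $(A,p)$ with $p:\Theta\to\mathbb{R}^4$ (payments to the agents) and $A:\Theta\to\{(1,1,0,0),(0,0,1,1)\}$ selecting, for every $\theta\in\Theta$, a path of minimum cost $\sum_i A_i(\theta)\theta_i$ (ties broken arbitrarily). $(A,p)$ is bribeproof if for all $\theta\in\Theta$, all agents $i,j$ and all $\hat\theta_i\in\Theta_i$, with $\hat\theta$ denoting $\theta$ with its $i$-th entry replaced by $\hat\theta_i$: if $i\neq j$, $p_i(\theta)-A_i(\theta)\theta_i+p_j(\theta)-A_j(\theta)\theta_j\ge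 p_i(\hat\theta)-A_i(\hat\theta)\theta_i+p_j(\hat\theta)-A_j(\hat\theta)\theta_j$; and, for $i=j$, $p_i(\theta)-A_i(\theta)\theta_i\ge p_i(\hat\theta)-A_i(\hat\theta)\theta_i$. *)

theory Defs
  imports "HOL-Analysis.Analysis"
begin

text \<open>
  Agents are the elements of the index type \<open>'n\<close>. A profile \<open>\<theta> $ i\<close> is the cost per unit of work
  of agent \<open>i\<close>. Allocation rules \<open>A\<close> and payment rules \<open>p\<close> are total functions on \<open>real ^ 'n\<close>;
  only their values on the type profiles in \<open>profiles T\<close> are ever constrained or used.
\<close>

definition profiles :: "('n::finite \<Rightarrow> real set) \<Rightarrow> (real ^ 'n) set" where
  "profiles T = {\<theta>. \<forall>i. \<theta> $ i \<in> T i}"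

definition replace :: "real ^ 'n \<Rightarrow> 'n::finite \<Rightarrow> real \<Rightarrow> real ^ 'n" where
  "replace \<theta> i t = (\<chi> k. if k = i then t else \<theta> $ k)"

text \<open>
  \<open>utility A p \<theta> r i\<close>: utility of agent \<open>i\<close> when the true costs are \<open>\<theta>\<close> and the reports are \<open>r\<close>.
\<close>

definition utility ::
    "(real ^ 'n \<Rightarrow> real ^ 'n) \<Rightarrow> (real ^ 'n \<Rightarrow> real ^ 'n) \<Rightarrow> real ^ 'n \<Rightarrow> real ^ 'n \<Rightarrow> 'n::finite \<Rightarrow> real"
  where "utility A p \<theta> r i = p r $ i - A r $ i * \<theta> $ i"

definition bribeproof ::
    "('n::finite \<Rightarrow> real set) \<Rightarrow> (real ^ 'n \<Rightarrow> real ^ 'n) \<Rightarrow> (real ^ 'n \<Rightarrow> real ^ 'n) \<Rightarrow> bool" where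
  "bribeproof T A p \<longleftrightarrow>
     (\<forall>\<theta>\<in>profiles T. \<forall>i j. \<forall>t\<in>T i.
        (i \<noteq> j \<longrightarrow> utility A p \<theta> \<theta> i + utility A p \<theta> \<theta> j
                   \<ge> utility A p \<theta> (replace \<theta> i t) i + utility A p \<theta> (replace \<theta> i t) j) \<and>
        (i = j \<longrightarrow> utility A p \<theta> \<theta> i \<ge> utility A p \<theta> (replace \<theta> i t) i))"

definition total_cost :: "real ^ 'n \<Rightarrow> real ^ 'n::finite \<Rightarrow> real" where
  "total_cost a \<theta> = (\<Sum>i\<in>UNIV. a $ i * \<theta> $ i)"

text \<open>
  The network has nodes \<open>s, u, d, t\<close>; agents \<open>1, 2, 3, 4\<close> own the edges \<open>su, ut, sd, dt\<close>.
  In the index type \<open>4\<close> the numeral \<open>4\<close> coincides with \<open>0\<close>, and \<open>1, 2, 3, 4\<close> are distinct and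
  exhaust the type.
\<close>

definition paths :: "(real ^ 4) set" where
  "paths = {vector [1, 1, 0, 0], vector [0, 0, 1, 1]}"

lemma vector_4:
  "(vector [w, x, y, z] :: 'a::zero ^ 4) $ 1 = w"
  "(vector [w, x, y, z] :: 'a::zero ^ 4) $ 2 = x"
  "(vector [w, x, y, z] :: 'a::zero ^ 4) $ 3 = y"
  "(vector [w, x, y, z] :: 'a::zero ^ 4) $ 4 = z"
  unfolding vector_def by simp_all

definition perturbed_types :: "real \<Rightarrow> real \<Rightarrow> real \<Rightarrow> 4 \<Rightarrow> real set" where
  "perturbed_types L H \<epsilon> i = (if i = 1 \<or> i = 2 then {L - \<epsilon>, H + \<epsilon>} else {L, H})"

definition min_cost_path_rule :: "(4 \<Rightarrow> real set) \<Rightarrow> (real ^ 4 \<Rightarrow> real ^ 4) \<Rightarrow> bool" where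
  "min_cost_path_rule T A \<longleftrightarrow>
     (\<forall>\<theta>\<in>profiles T. A \<theta> \<in> paths \<and> (\<forall>a\<in>paths. total_cost (A \<theta>) \<theta> \<le> total_cost a \<theta>))"

end

theory Submission
  imports Defs
begin

text \<open>
  Payments do not change along single-agent misreports that leave the allocation unchanged. Making
  the selected path better keeps it selected, so every profile choosing the upper path is linked in
  this way to the profile where that path is cheapest and the lower one dearest, and symmetrically
  for the lower path. Hence all payments are described by two vectors \<open>PU\<close> and \<open>PD\<close>.
  The tied profiles \<open>(L - \<epsilon>, H + \<epsilon>, L, H)\<close> and \<open>(H + \<epsilon>, L - \<epsilon>, H, L)\<close> have, however the ties
  are broken, neighbours choosing the other path; the two-agent constraints there form a linear
  system whose only possible solution is \<open>PU - PD = (m, m, -m, -m)\<close> with \<open>m = (L + H) / 2\<close>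
  (the system is infeasible for \<open>\<epsilon> > 0\<close>).
\<close>

lemma replace_nth: "replace \<theta> i t $ k = (if k = i then t else \<theta> $ k)"
  by (simp add: replace_def)

lemma replace_self: "replace \<theta> i (\<theta> $ i) = \<theta>"
  by (simp add: vec_eq_iff replace_nth)

lemma replace_replace_self: "replace (replace \<theta> i t) i (\<theta> $ i) = \<theta>"
  by (simp add: vec_eq_iff replace_nth)

lemma replace_in_profiles: "\<theta> \<in> profiles T \<Longrightarrow> t \<in> T i \<Longrightarrow> replace \<theta> i t \<in> profiles T"
  by (simp add: profiles_def replace_nth)

lemma total_cost_replace:
  "total_cost a (replace \<theta> i t) = total_cost a \<theta> + a $ i * (t - \<theta> $ i)"
proof -
  have "total_cost a (replace \<theta> i t) - total_cost a \<theta>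
      = (\<Sum>k\<in>UNIV. if k = i then a $ k * (t - \<theta> $ k) else 0)"
    unfolding total_cost_def sum_subtractf[symmetric]
    by (rule sum.cong) (auto simp: replace_nth algebra_simps)
  then show ?thesis by simp
qed

lemma bribeproof_pair:
  assumes "bribeproof T A p" "\<theta> \<in> profiles T" "t \<in> T i" "i \<noteq> j"
  shows "utility A p \<theta> (replace \<theta> i t) i + utility A p \<theta> (replace \<theta> i t) j
       \<le> utility A p \<theta> \<theta> i + utility A p \<theta> \<theta> j"
  using assms unfolding bribeproof_def by blast

lemma bribeproof_single:
  assumes "bribeproof T A p" "\<theta> \<in> profiles T" "t \<in> T i"
  shows "utility A p \<theta> (replace \<theta> i t) i \<le> utility A p \<theta> \<theta> i"
  using assms unfolding bribeproof_def by blast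

text \<open>With equal allocations all cost terms cancel. The misreport and its reversal bound the
  payment of agent \<open>i\<close> from both sides; the two-agent constraints do the same for its
  sum with any other payment.\<close>

lemma bribeproof_payment_eq:
  assumes bp: "bribeproof T A p" and \<theta>: "\<theta> \<in> profiles T" and t: "t \<in> T i"
    and A: "A (replace \<theta> i t) = A \<theta>"
  shows "p (replace \<theta> i t) = p \<theta>"
proof -
  let ?\<theta>' = "replace \<theta> i t"
  have \<theta>': "?\<theta>' \<in> profiles T" using \<theta> t by (rule replace_in_profiles)
  have ti: "\<theta> $ i \<in> T i" using \<theta> by (simp add: profiles_def)
  have i: "p ?\<theta>' $ i = p \<theta> $ i"
    using bribeproof_single[OF bp \<theta> t] bribeproof_single[OF bp \<theta>' ti]
    by (simp add: replace_replace_self utility_def A)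
  have "p ?\<theta>' $ j = p \<theta> $ j" for j
  proof (cases "j = i")
    case False
    then show ?thesis
      using bribeproof_pair[OF bp \<theta> t, of j] bribeproof_pair[OF bp \<theta>' ti, of j] i
      by (simp add: replace_replace_self utility_def A)
  qed (simp add: i)
  then show ?thesis by (simp add: vec_eq_iff)
qed

text \<open>Before the move \<open>A \<theta>\<close> costs at most as much as any \<open>b\<close>,
  and \<open>better\<close> shifts each gap strictly in its favour, so afterwards it is the unique
  minimum and no tie can displace it. The guard \<open>t \<noteq> \<theta> $ i\<close> admits moves
  that change nothing.\<close>

lemma allocation_and_payment_kept:
  assumes mc: "min_cost_path_rule T A" and bp: "bribeproof T A p"
    and \<theta>: "\<theta> \<in> profiles T" and t: "t \<in> T i"
    and better: "t \<noteq> \<theta> $ i \<Longrightarrow> (\<And>b. b \<in> paths \<Longrightarrow> b \<noteq> A \<theta> \<Longrightarrow> (A \<theta> $ i - b $ i) * (t - \<theta> $ i) < 0)"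
  shows "A (replace \<theta> i t) = A \<theta> \<and> p (replace \<theta> i t) = p \<theta>"
proof -
  let ?\<theta>' = "replace \<theta> i t"
  have "A ?\<theta>' = A \<theta>"
  proof (rule ccontr)
    assume ne: "A ?\<theta>' \<noteq> A \<theta>"
    then have "t \<noteq> \<theta> $ i" by (auto simp: replace_self)
    have "?\<theta>' \<in> profiles T" using \<theta> t by (rule replace_in_profiles)
    then have "A ?\<theta>' \<in> paths" "total_cost (A ?\<theta>') ?\<theta>' \<le> total_cost (A \<theta>) ?\<theta>'"
      and "total_cost (A \<theta>) \<theta> \<le> total_cost (A ?\<theta>') \<theta>"
      using mc \<theta> unfolding min_cost_path_rule_def by blast+
    with better[OF \<open>t \<noteq> \<theta> $ i\<close> \<open>A ?\<theta>' \<in> paths\<close> ne] show False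
      by (simp add: total_cost_replace algebra_simps)
  qed
  then show ?thesis using bribeproof_payment_eq[OF bp \<theta> t] by simp
qed

lemma replace_vector_4:
  "replace (vector [w, x, y, z] :: real ^ 4) 1 t = vector [t, x, y, z]"
  "replace (vector [w, x, y, z] :: real ^ 4) 2 t = vector [w, t, y, z]"
  "replace (vector [w, x, y, z] :: real ^ 4) 3 t = vector [w, x, t, z]"
  "replace (vector [w, x, y, z] :: real ^ 4) 4 t = vector [w, x, y, t]"
  by (simp_all add: vec_eq_iff forall_4 replace_nth vector_4)

theorem theorem14:
  fixes L H \<epsilon> :: real and A p :: "real ^ 4 \<Rightarrow> real ^ 4"
  assumes "L < H" and "\<epsilon> \<ge> 0"
    and "min_cost_path_rule (perturbed_types L H \<epsilon>) A"
    and "bribeproof (perturbed_types L H \<epsilon>) A p"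
  shows "\<exists>f :: real ^ 4. \<forall>\<theta>\<in>profiles (perturbed_types L H \<epsilon>). \<forall>i.
           p \<theta> $ i = f $ i + A \<theta> $ i * ((L + H) / 2)"
proof -
  define T where "T = perturbed_types L H \<epsilon>"
  define l h where "l = L - \<epsilon>" and "h = H + \<epsilon>"
  define up dn :: "real ^ 4" where "up = vector [1, 1, 0, 0]" and "dn = vector [0, 0, 1, 1]"
  define PU PD where "PU = p (vector [l, l, H, H])" and "PD = p (vector [h, h, L, L])"
  have mc: "min_cost_path_rule T A" and bp: "bribeproof T A p"
    using assms by (simp_all add: T_def)
  have lh: "l < h" using assms by (simp add: l_def h_def)
  have T: "T 1 = {l, h}" "T 2 = {l, h}" "T 3 = {L, H}" "T 4 = {L, H}"
    by (simp_all add: T_def perturbed_types_def l_def h_def)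
  have up: "up $ 1 = 1" "up $ 2 = 1" "up $ 3 = 0" "up $ 4 = 0"
    and dn: "dn $ 1 = 0" "dn $ 2 = 0" "dn $ 3 = 1" "dn $ 4 = 1"
    by (simp_all add: up_def dn_def vector_4)
  have ne: "up \<noteq> dn" using up dn by (metis zero_neq_one)
  have paths: "paths = {up, dn}" by (simp add: paths_def up_def dn_def)
  have prof: "\<theta> \<in> profiles T \<longleftrightarrow>
      \<theta> $ 1 \<in> {l, h} \<and> \<theta> $ 2 \<in> {l, h} \<and> \<theta> $ 3 \<in> {L, H} \<and> \<theta> $ 4 \<in> {L, H}" for \<theta>
    by (simp add: profiles_def forall_4 T)
  \<comment> \<open>The listed moves send an edge of the selected path to its low cost or an edge of
    the other path to its high cost. Membership in \<open>profiles T\<close> is included so that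
    moves can be chained.\<close>
  have keep: "A (replace \<theta> i t) = A \<theta> \<and> p (replace \<theta> i t) = p \<theta> \<and> replace \<theta> i t \<in> profiles T"
    if "\<theta> \<in> profiles T" and "A \<theta> = up \<and> (i, t) \<in> {(1, l), (2, l), (3, H), (4, H)} \<or>
      A \<theta> = dn \<and> (i, t) \<in> {(1, h), (2, h), (3, L), (4, L)}" for \<theta> i t
  proof -
    have t: "t \<in> T i" using that(2) T by auto
    have "A (replace \<theta> i t) = A \<theta> \<and> p (replace \<theta> i t) = p \<theta>"
    proof (rule allocation_and_payment_kept[where T = T, OF mc bp that(1) t])
      fix b assume ne: "t \<noteq> \<theta> $ i" and b: "b \<in> paths" "b \<noteq> A \<theta>"
      show "(A \<theta> $ i - b $ i) * (t - \<theta> $ i) < 0"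
        using that(2)
      proof
        assume *: "A \<theta> = up \<and> (i, t) \<in> {(1, l), (2, l), (3, H), (4, H)}"
        with b have A: "A \<theta> = up" "b = dn" by (simp_all add: paths)
        show ?thesis unfolding A using conjunct2[OF *] ne that(1) lh \<open>L < H\<close>
          by (auto simp: up dn prof)
      next
        assume *: "A \<theta> = dn \<and> (i, t) \<in> {(1, h), (2, h), (3, L), (4, L)}"
        with b have A: "A \<theta> = dn" "b = up" by (simp_all add: paths)
        show ?thesis unfolding A using conjunct2[OF *] ne that(1) lh \<open>L < H\<close>
          by (auto simp: up dn prof)
      qed
    qed
    with replace_in_profiles[of \<theta> T t i] that(1) t show ?thesis by simp
  qed
  have pay_up: "p \<theta> = PU" if \<theta>: "\<theta> \<in> profiles T" and A: "A \<theta> = up" for \<theta>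
  proof -
    let ?a = "replace \<theta> 1 l" let ?b = "replace ?a 2 l" let ?c = "replace ?b 3 H"
    let ?d = "replace ?c 4 H"
    have "p ?a = p \<theta>" "A ?a = up" "?a \<in> profiles T" using keep[of \<theta> 1 l] \<theta> A by simp_all
    moreover from this have "p ?b = p \<theta>" "A ?b = up" "?b \<in> profiles T"
      using keep[of ?a 2 l] by simp_all
    moreover from this have "p ?c = p \<theta>" "A ?c = up" "?c \<in> profiles T"
      using keep[of ?b 3 H] by simp_all
    moreover from this have "p ?d = p \<theta>" using keep[of ?c 4 H] by simp
    moreover have "?d = vector [l, l, H, H]"
      by (simp add: vec_eq_iff forall_4 replace_nth vector_4)
    ultimately show ?thesis by (simp add: PU_def)
  qed
  have pay_dn: "p \<theta> = PD" if \<theta>: "\<theta> \<in> profiles T" and A: "A \<theta> = dn" for \<theta>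
  proof -
    let ?a = "replace \<theta> 1 h" let ?b = "replace ?a 2 h" let ?c = "replace ?b 3 L"
    let ?d = "replace ?c 4 L"
    have "p ?a = p \<theta>" "A ?a = dn" "?a \<in> profiles T" using keep[of \<theta> 1 h] \<theta> A by simp_all
    moreover from this have "p ?b = p \<theta>" "A ?b = dn" "?b \<in> profiles T"
      using keep[of ?a 2 h] by simp_all
    moreover from this have "p ?c = p \<theta>" "A ?c = dn" "?c \<in> profiles T"
      using keep[of ?b 3 L] by simp_all
    moreover from this have "p ?d = p \<theta>" using keep[of ?c 4 L] by simp
    moreover have "?d = vector [h, h, L, L]"
      by (simp add: vec_eq_iff forall_4 replace_nth vector_4)
    ultimately show ?thesis by (simp add: PD_def)
  qed
  have A_cases: "A \<theta> = up \<or> A \<theta> = dn" if "\<theta> \<in> profiles T" for \<theta>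
    using mc that unfolding min_cost_path_rule_def paths by blast
  have A_up: "A \<theta> = up" if "\<theta> \<in> profiles T" "\<theta> $ 1 + \<theta> $ 2 < \<theta> $ 3 + \<theta> $ 4" for \<theta>
  proof (rule ccontr)
    assume "A \<theta> \<noteq> up"
    with A_cases that have "A \<theta> = dn" by blast
    moreover have "total_cost (A \<theta>) \<theta> \<le> total_cost up \<theta>"
      using mc that(1) unfolding min_cost_path_rule_def paths by blast
    ultimately show False using that(2) by (simp add: total_cost_def sum_4 up dn)
  qed
  have A_dn: "A \<theta> = dn" if "\<theta> \<in> profiles T" "\<theta> $ 3 + \<theta> $ 4 < \<theta> $ 1 + \<theta> $ 2" for \<theta>
  proof (rule ccontr)
    assume "A \<theta> \<noteq> dn"
    with A_cases that have "A \<theta> = up" by blast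
    moreover have "total_cost (A \<theta>) \<theta> \<le> total_cost dn \<theta>"
      using mc that(1) unfolding min_cost_path_rule_def paths by blast
    ultimately show False using that(2) by (simp add: total_cost_def sum_4 up dn)
  qed
  \<comment> \<open>Since \<open>l + h = L + H\<close>, \<open>m\<close> is the midpoint of all four
    type sets. \<open>D\<close> compares the payments net of \<open>m\<close> per unit of work on
    the two paths, so it suffices to show that it vanishes.\<close>
  define m where "m = (L + H) / 2"
  define D where "D = (\<lambda>i. PD $ i - m * dn $ i - (PU $ i - m * up $ i))"
  define w where "w = dn - up"
  have w: "w $ 1 = -1" "w $ 2 = -1" "w $ 3 = 1" "w $ 4 = 1" by (simp_all add: w_def up dn)
  \<comment> \<open>The upper bound deters the pair \<open>i\<close>, \<open>j\<close> at
    \<open>\<theta>\<close> from inducing the lower path; the lower bound deters the reverse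
    misreport at the replaced profile, where only the cost of \<open>i\<close> differs.\<close>
  have switch: "D i + D j \<le> w $ i * (\<theta> $ i - m) + w $ j * (\<theta> $ j - m)"
    "w $ i * (t - m) + w $ j * (\<theta> $ j - m) \<le> D i + D j"
    if "\<theta> \<in> profiles T" "t \<in> T i" "i \<noteq> j" "A \<theta> = up" "A (replace \<theta> i t) = dn" for \<theta> i j t
  proof -
    have \<theta>': "replace \<theta> i t \<in> profiles T" using that(1,2) by (rule replace_in_profiles)
    have ti: "\<theta> $ i \<in> T i" using that(1) by (simp add: profiles_def)
    note U = pay_up[OF that(1) that(4)] and D = pay_dn[OF \<theta>' that(5)]
    show "D i + D j \<le> w $ i * (\<theta> $ i - m) + w $ j * (\<theta> $ j - m)"
      using bribeproof_pair[OF bp that(1-3)]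
      by (simp add: utility_def U D that(4,5) D_def w_def algebra_simps)
    show "w $ i * (t - m) + w $ j * (\<theta> $ j - m) \<le> D i + D j"
      using bribeproof_pair[OF bp \<theta>' ti that(3)] that(3)
      by (simp add: utility_def U D that(4,5) replace_replace_self replace_nth D_def w_def
          algebra_simps)
  qed
  \<comment> \<open>At \<open>(l, h, L, H)\<close> both paths cost \<open>L + H\<close>. The first
    four bounds hold under either tie-break; the last disjunction has one alternative for
    each.\<close>
  have tie13: "D 1 - D 2 \<ge> 2 * \<epsilon>" "D 4 \<ge> D 3"
    "D 1 + D 4 \<ge> - \<epsilon>" "D 2 + D 3 \<le> \<epsilon>"
    "D 1 + D 2 \<le> 0 \<and> D 3 + D 4 \<le> 0 \<or> D 1 + D 2 \<ge> 0 \<and> D 3 + D 4 \<ge> 0"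
  proof -
    have mem: "vector [l, h, L, H] \<in> profiles T" "vector [h, h, L, H] \<in> profiles T" "vector [l, l, L, H] \<in> profiles T"
      "vector [l, h, H, H] \<in> profiles T" "vector [l, h, L, L] \<in> profiles T"
      by (simp_all add: prof vector_4)
    \<comment> \<open>One changed entry breaks the tie strictly, as \<open>L < H\<close> and
      \<open>\<epsilon> \<ge> 0\<close>, so these neighbours have forced allocations.\<close>
    have A: "A (vector [h, h, L, H]) = dn" "A (vector [l, h, L, L]) = dn" "A (vector [l, l, L, H]) = up" "A (vector [l, h, H, H]) = up"
      using assms(1,2) A_dn[OF mem(2)] A_dn[OF mem(5)] A_up[OF mem(3)] A_up[OF mem(4)]
      by (simp_all add: vector_4 l_def h_def)
    consider "A (vector [l, h, L, H]) = up" | "A (vector [l, h, L, H]) = dn" using A_cases mem(1) by blast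
    then have "D 1 - D 2 \<ge> 2 * \<epsilon> \<and> D 4 \<ge> D 3 \<and> D 1 + D 4 \<ge> - \<epsilon> \<and> D 2 + D 3 \<le> \<epsilon> \<and>
      (D 1 + D 2 \<le> 0 \<and> D 3 + D 4 \<le> 0 \<or> D 1 + D 2 \<ge> 0 \<and> D 3 + D 4 \<ge> 0)"
    proof cases
      \<comment> \<open>Agent 1 rising or agent 4 falling diverts the choice to the lower path. This
        yields \<open>D 1 + D 4 \<ge> \<epsilon>\<close>,
        \<open>D 2 + D 4 \<le> - \<epsilon>\<close>, \<open>D 1 + D 3 \<le> \<epsilon>\<close>, and
        nonpositive \<open>D 1 + D 2\<close> and \<open>D 3 + D 4\<close>.\<close>
      case 1
      show ?thesis
        using
        switch[of "vector [l, h, L, H]" h 1 2]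
        switch[of "vector [l, h, L, H]" h 1 3]
        switch[of "vector [l, h, L, H]" h 1 4]
        switch[of "vector [l, h, L, H]" L 4 1]
        switch[of "vector [l, h, L, H]" L 4 2]
        switch[of "vector [l, h, L, H]" L 4 3]
        by (simp add: replace_vector_4 vector_4 mem A T w 1)
          (use assms(1,2) in \<open>auto simp: l_def h_def m_def field_simps\<close>)
    next
      \<comment> \<open>Here the upper path is chosen at the neighbours, and agent 2 or 3 moves into
        the tie. This yields \<open>D 1 + D 3 \<ge> \<epsilon>\<close>,
        \<open>D 2 + D 3 \<le> - \<epsilon>\<close>, \<open>D 2 + D 4 \<ge> - \<epsilon>\<close>,
        and nonnegative \<open>D 1 + D 2\<close> and \<open>D 3 + D 4\<close>.\<close>
      case 2
      show ?thesis
        using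
        switch[of "vector [l, l, L, H]" h 2 1]
        switch[of "vector [l, l, L, H]" h 2 3]
        switch[of "vector [l, l, L, H]" h 2 4]
        switch[of "vector [l, h, H, H]" L 3 1]
        switch[of "vector [l, h, H, H]" L 3 2]
        switch[of "vector [l, h, H, H]" L 3 4]
        by (simp add: replace_vector_4 vector_4 mem A T w 2)
          (use assms(1,2) in \<open>auto simp: l_def h_def m_def field_simps\<close>)
    qed
    then show "D 1 - D 2 \<ge> 2 * \<epsilon>" "D 4 \<ge> D 3"
      "D 1 + D 4 \<ge> - \<epsilon>" "D 2 + D 3 \<le> \<epsilon>"
      "D 1 + D 2 \<le> 0 \<and> D 3 + D 4 \<le> 0 \<or> D 1 + D 2 \<ge> 0 \<and> D 3 + D 4 \<ge> 0"
      by simp_all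
  qed
  \<comment> \<open>The mirror image at \<open>(h, l, H, L)\<close>, with agents 1 and 2 exchanged
    and agents 3 and 4 exchanged. This tie may be broken independently of the other one.\<close>
  have tie24: "D 2 - D 1 \<ge> 2 * \<epsilon>" "D 3 \<ge> D 4"
    "D 2 + D 3 \<ge> - \<epsilon>" "D 1 + D 4 \<le> \<epsilon>"
    "D 2 + D 1 \<le> 0 \<and> D 4 + D 3 \<le> 0 \<or> D 2 + D 1 \<ge> 0 \<and> D 4 + D 3 \<ge> 0"
  proof -
    have mem: "vector [h, l, H, L] \<in> profiles T" "vector [h, h, H, L] \<in> profiles T" "vector [l, l, H, L] \<in> profiles T"
      "vector [h, l, H, H] \<in> profiles T" "vector [h, l, L, L] \<in> profiles T"
      by (simp_all add: prof vector_4)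
    have A: "A (vector [h, h, H, L]) = dn" "A (vector [h, l, L, L]) = dn" "A (vector [l, l, H, L]) = up" "A (vector [h, l, H, H]) = up"
      using assms(1,2) A_dn[OF mem(2)] A_dn[OF mem(5)] A_up[OF mem(3)] A_up[OF mem(4)]
      by (simp_all add: vector_4 l_def h_def)
    consider "A (vector [h, l, H, L]) = up" | "A (vector [h, l, H, L]) = dn" using A_cases mem(1) by blast
    then have "D 2 - D 1 \<ge> 2 * \<epsilon> \<and> D 3 \<ge> D 4 \<and> D 2 + D 3 \<ge> - \<epsilon> \<and> D 1 + D 4 \<le> \<epsilon> \<and>
      (D 2 + D 1 \<le> 0 \<and> D 4 + D 3 \<le> 0 \<or> D 2 + D 1 \<ge> 0 \<and> D 4 + D 3 \<ge> 0)"
    proof cases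
      case 1
      show ?thesis
        using
        switch[of "vector [h, l, H, L]" h 2 1]
        switch[of "vector [h, l, H, L]" h 2 4]
        switch[of "vector [h, l, H, L]" h 2 3]
        switch[of "vector [h, l, H, L]" L 3 2]
        switch[of "vector [h, l, H, L]" L 3 1]
        switch[of "vector [h, l, H, L]" L 3 4]
        by (simp add: replace_vector_4 vector_4 mem A T w 1)
          (use assms(1,2) in \<open>auto simp: l_def h_def m_def field_simps\<close>)
    next
      case 2
      show ?thesis
        using
        switch[of "vector [l, l, H, L]" h 1 2]
        switch[of "vector [l, l, H, L]" h 1 4]
        switch[of "vector [l, l, H, L]" h 1 3]
        switch[of "vector [h, l, H, H]" L 4 2]
        switch[of "vector [h, l, H, H]" L 4 1]
        switch[of "vector [h, l, H, H]" L 4 3]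
        by (simp add: replace_vector_4 vector_4 mem A T w 2)
          (use assms(1,2) in \<open>auto simp: l_def h_def m_def field_simps\<close>)
    qed
    then show "D 2 - D 1 \<ge> 2 * \<epsilon>" "D 3 \<ge> D 4"
      "D 2 + D 3 \<ge> - \<epsilon>" "D 1 + D 4 \<le> \<epsilon>"
      "D 2 + D 1 \<le> 0 \<and> D 4 + D 3 \<le> 0 \<or> D 2 + D 1 \<ge> 0 \<and> D 4 + D 3 \<ge> 0"
      by simp_all
  qed
  \<comment> \<open>Adding the two bounds with \<open>2 * \<epsilon>\<close> forces
    \<open>\<epsilon> = 0\<close>. Then \<open>D 1 = D 2\<close>, \<open>D 3 = D 4\<close> and
    \<open>D 1 + D 4 = 0\<close>, so \<open>D 1 + D 2\<close> and \<open>D 3 + D 4\<close> are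
    opposite; sharing a sign, both vanish.\<close>
  have D0: "D 1 = 0 \<and> D 2 = 0 \<and> D 3 = 0 \<and> D 4 = 0"
    using tie13 tie24 \<open>\<epsilon> \<ge> 0\<close> by linarith
  then have PD: "PD $ i = PU $ i - m * up $ i + m * dn $ i" for i
    using exhaust_4[of i] by (auto simp: D_def algebra_simps)
  \<comment> \<open>The constant \<open>f\<close> is the upper-path payment net of \<open>m\<close>
    per unit of work; by \<open>PD\<close> the lower path gives the same vector.\<close>
  have "p \<theta> $ i = (PU - m *\<^sub>R up) $ i + A \<theta> $ i * ((L + H) / 2)"
    if \<theta>: "\<theta> \<in> profiles T" for \<theta> i
    using A_cases[OF \<theta>]
  proof
    assume "A \<theta> = up"
    with pay_up[OF \<theta>] show ?thesis by (simp add: m_def)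
  next
    assume "A \<theta> = dn"
    with pay_dn[OF \<theta>] show ?thesis by (simp add: PD m_def)
  qed
  then show ?thesis unfolding T_def by blast
qed

end
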